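(* Let $G=(V,E)$ be a simple graph and $d=|V|+|E|$. Then \[ \mathrm{vol}(\mathscr{Q}(G))=\frac{\mathrm{vol}(\mathscr{O}(G))}{2^{|E|}}=\frac{e(\mathscr{V}(G),\prec)}{d!\,2^{|E|}}, \] where volumes are $d$-dimensional.
   Context: Polytopes are in $\mathbb{R}^{|V|+|E|}$ with coordinates $x_i$ ($i\in V$) and $y_{ij}$ ($(i,j)\in E$). $\mathscr{Q}(G)$ is the set of points with all coordinates in $[0,1]$ satisfying, for each $(i,j)\in E$: $y_{ij}\ge0$, $y_{ij}\le x_i$, $y_{ij}\le x_j$, $x_i+x_j\le 1+y_{ij}$. $\mathscr{O}(G)$ is the set of points with all coordinates in $[0,1]$ satisfying $y_{ij}\le x_i$, $y_{ij}\le x_j$ for each $(i,j)\in E$. The incidence poset $(\mathscr{V}(G),\prec)$ has ground set $\mathscr{V}(G)=\{x_i: i\in V\}\cup\{y_{ij}:(i,j)\in E\}$ with order generated by $y_{ij}\prec x_i$ and $y_{ij}\prec x_j$ for all $(i,j)\in E$; $e(\mathscr{V}(G),\prec)$ is its number of linear extensions. *)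

theory Defs
  imports "HOL-Analysis.Analysis"
begin

definition simple_graph :: "'v set \<Rightarrow> 'v set set \<Rightarrow> bool" where
  "simple_graph V E \<longleftrightarrow> finite V \<and> (\<forall>e\<in>E. e \<subseteq> V \<and> card e = 2)"

text \<open>
  \<open>XC i\<close> is the coordinate $x_i$ and \<open>YC {i, j}\<close> is the coordinate $y_{ij}$. The space of
  dimension $|V| + |E|$ consists of the real functions on \<open>coords V E\<close>, represented as usual by
  functions that are \<open>undefined\<close> outside this set.
\<close>

datatype 'v coord = XC 'v | YC "'v set"

definition coords :: "'v set \<Rightarrow> 'v set set \<Rightarrow> 'v coord set" where
  "coords V E = XC ` V \<union> YC ` E"

definition polytope_Q :: "'v set \<Rightarrow> 'v set set \<Rightarrow> ('v coord \<Rightarrow> real) set" where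
  "polytope_Q V E =
    {p \<in> coords V E \<rightarrow>\<^sub>E {0..1}. \<forall>i j. {i, j} \<in> E \<longrightarrow>
       p (YC {i, j}) \<ge> 0 \<and>
       p (YC {i, j}) \<le> p (XC i) \<and>
       p (YC {i, j}) \<le> p (XC j) \<and>
       p (XC i) + p (XC j) \<le> 1 + p (YC {i, j})}"

definition polytope_O :: "'v set \<Rightarrow> 'v set set \<Rightarrow> ('v coord \<Rightarrow> real) set" where
  "polytope_O V E =
    {p \<in> coords V E \<rightarrow>\<^sub>E {0..1}. \<forall>i j. {i, j} \<in> E \<longrightarrow>
       p (YC {i, j}) \<le> p (XC i) \<and>
       p (YC {i, j}) \<le> p (XC j)}"

definition vol :: "'i set \<Rightarrow> ('i \<Rightarrow> real) set \<Rightarrow> real" where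
  "vol I S = measure (\<Pi>\<^sub>M c\<in>I. lborel) S"

text \<open>The reflexive version of the order; a pair \<open>(a, b)\<close> means that \<open>a\<close> lies below \<open>b\<close>.\<close>

definition incidence_order :: "'v set \<Rightarrow> 'v set set \<Rightarrow> 'v coord rel" where
  "incidence_order V E =
    {(YC e, XC i) | e i. e \<in> E \<and> i \<in> e}\<^sup>* \<inter> (coords V E \<times> coords V E)"

definition linear_extensions :: "'a set \<Rightarrow> 'a rel \<Rightarrow> 'a rel set" where
  "linear_extensions A r = {L. linear_order_on A L \<and> r \<subseteq> L}"

end

theory Submission
  imports Defs "HOL-Probability.Probability"
begin

text \<open>
  For vertex values \<open>a\<close>, \<open>b\<close> in the unit interval, the edge coordinate ranges over an interval of length
  \<open>min a b\<close> in the polytope O, and of length \<open>min a b - max 0 (a + b - 1)\<close> in the polytope Q. The latter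
  equals \<open>1 / 2 * min (tent a) (tent b)\<close> for the tent map \<open>tent t = min (2 * t) (2 - 2 * t)\<close>. As the tent
  map preserves the uniform distribution, integrating the product of these lengths over the vertex
  values shows that the volumes differ by a factor of 2 for each edge.

  Up to a null set, the cube splits into the cells on which the coordinates are ordered by a given
  linear order. Permuting the coordinates shows that all \<open>d!\<close> cells have the same volume, and the
  polytope O consists of the cells belonging to linear extensions of the incidence order.
\<close>

section \<open>Linear orders on a finite set as rankings\<close>

definition order_by :: "'a set \<Rightarrow> ('a \<Rightarrow> 'b::linorder) \<Rightarrow> 'a rel" where
  "order_by A f = {(a, b). a \<in> A \<and> b \<in> A \<and> f a \<le> f b}"

lemma order_by_eq_iff:
  "order_by A f = order_by A g \<longleftrightarrow> (\<forall>a\<in>A. \<forall>b\<in>A. f a \<le> f b \<longleftrightarrow> g a \<le> g b)"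
  by (auto simp: order_by_def set_eq_iff)

lemma linear_order_order_by: "inj_on f A \<Longrightarrow> linear_order_on A (order_by A f)"
  by (auto simp: order_by_def linear_order_on_def partial_order_on_def preorder_on_def refl_on_def
      trans_def antisym_def total_on_def inj_on_def)

text \<open>A bijection onto an initial segment of the naturals can be recovered from its order: its
  value at \<open>a\<close> is the number of elements strictly below \<open>a\<close>.\<close>

lemma order_by_bij_eq_imp_eq:
  fixes f g :: "'a \<Rightarrow> nat"
  assumes f: "bij_betw f A {..<n}" and g: "bij_betw g A {..<n}"
    and eq: "order_by A f = order_by A g" and a: "a \<in> A"
  shows "f a = g a"
proof -
  have val: "h a = card {b \<in> A. h b < h a}" if h: "bij_betw h A {..<n}" for h :: "'a \<Rightarrow> nat"
  proof -
    have "h a < n"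
      using h a by (auto simp: bij_betw_def)
    have "h ` {b \<in> A. h b < h a} = h ` A \<inter> {..<h a}"
      by auto
    also have "\<dots> = {..<h a}"
      using h \<open>h a < n\<close> by (auto simp: bij_betw_def)
    finally have "h ` {b \<in> A. h b < h a} = {..<h a}" .
    moreover have "inj_on h {b \<in> A. h b < h a}"
      using h by (auto simp: bij_betw_def inj_on_def)
    ultimately show ?thesis
      by (metis card_image card_lessThan)
  qed
  have "{b \<in> A. f b < f a} = {b \<in> A. g b < g a}"
    using eq a by (auto simp: order_by_eq_iff simp flip: not_le)
  then show ?thesis
    using val[OF f] val[OF g] by simp
qed

text \<open>The witness is the rank function, which counts strict predecessors. It is strictly
  monotone along \<open>L\<close> by transitivity and antisymmetry, hence injective by totality, and
  its values lie below \<open>card A\<close>.\<close>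

lemma linear_order_on_eq_order_by:
  assumes fin: "finite A" and L: "linear_order_on A L"
  obtains f :: "'a \<Rightarrow> nat" where "bij_betw f A {..<card A}" "L = order_by A f"
proof -
  define f where "f a = card {b. (b, a) \<in> L \<and> b \<noteq> a}" for a
  have refl: "a \<in> A \<Longrightarrow> (a, a) \<in> L" and sub: "L \<subseteq> A \<times> A" and tr: "trans L"
    and anti: "antisym L" and tot: "total_on A L" for a
    using L by (auto simp: linear_order_on_def partial_order_on_def preorder_on_def refl_on_def)
  have fin': "finite {b. (b, a) \<in> L \<and> b \<noteq> a}" for a
    by (rule finite_subset[OF _ fin]) (use sub in auto)
  have less: "f a < f b" if "(a, b) \<in> L" "a \<noteq> b" for a b
    unfolding f_def
  proof (rule psubset_card_mono[OF fin'])
    show "{c. (c, a) \<in> L \<and> c \<noteq> a} \<subset> {c. (c, b) \<in> L \<and> c \<noteq> b}"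
      using that tr anti unfolding trans_def antisym_def by blast
  qed
  have inj: "inj_on f A"
  proof (rule inj_onI, rule ccontr)
    fix a b assume "a \<in> A" "b \<in> A" "f a = f b" "a \<noteq> b"
    then have "(a, b) \<in> L \<or> (b, a) \<in> L"
      using tot by (auto simp: total_on_def)
    then show False
      using less \<open>f a = f b\<close> \<open>a \<noteq> b\<close> by fastforce
  qed
  have "f a < card A" if "a \<in> A" for a
    unfolding f_def by (rule psubset_card_mono[OF fin]) (use sub that in auto)
  then have "f ` A = {..<card A}"
    by (intro card_subset_eq) (auto simp: card_image[OF inj])
  then have "bij_betw f A {..<card A}"
    using inj by (simp add: bij_betw_def)
  moreover have "L = order_by A f"
  proof -
    have "(a, b) \<in> L \<longleftrightarrow> f a \<le> f b" if ab: "a \<in> A" "b \<in> A" for a b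
    proof (cases "a = b")
      case True
      then show ?thesis
        using refl ab by simp
    next
      case False
      then have "(a, b) \<in> L \<or> (b, a) \<in> L"
        using tot ab by (auto simp: total_on_def)
      then show ?thesis
        using less[of a b] less[of b a] False by fastforce
    qed
    then show ?thesis
      using sub by (auto simp: order_by_def)
  qed
  ultimately show thesis
    by (rule that)
qed

text \<open>Rankings and linear orders correspond bijectively via \<open>order_by\<close>.
  Extensional functions make the ranking unique, so counting orders becomes counting injections
  between two sets of equal size.\<close>

lemma card_linear_orders:
  assumes fin: "finite A"
  shows "card {L. linear_order_on A L} = fact (card A)"
proof -
  let ?F = "{f \<in> A \<rightarrow>\<^sub>E {..<card A}. inj_on f A}"
  have bij: "bij_betw f A {..<card A}" if "f \<in> ?F" for f
  proof -
    have "f ` A \<subseteq> {..<card A}" "inj_on f A"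
      using that by auto
    then show ?thesis
      by (simp add: bij_betw_def card_subset_eq card_image)
  qed
  have "bij_betw (order_by A) ?F {L. linear_order_on A L}"
    unfolding bij_betw_def
  proof (intro conjI equalityI subsetI)
    show "inj_on (order_by A) ?F"
    proof (rule inj_onI)
      fix f g assume fg: "f \<in> ?F" "g \<in> ?F" "order_by A f = order_by A g"
      have "f a = g a" if "a \<in> A" for a
        using order_by_bij_eq_imp_eq[OF bij[OF fg(1)] bij[OF fg(2)] fg(3) that] .
      then show "f = g"
        using fg by (intro PiE_ext[of f A "\<lambda>_. {..<card A}" g]) simp_all
    qed
  next
    fix L assume "L \<in> order_by A ` ?F"
    then show "L \<in> {L. linear_order_on A L}"
      by (auto intro: linear_order_order_by)
  next
    fix L assume "L \<in> {L. linear_order_on A L}"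
    then obtain f :: "'a \<Rightarrow> nat" where f: "bij_betw f A {..<card A}" "L = order_by A f"
      using linear_order_on_eq_order_by[OF fin] by blast
    \<comment> \<open>Restriction makes the ranking extensional without changing the order it
      induces on \<open>A\<close>.\<close>
    have "restrict f A \<in> ?F"
      using f(1) by (simp add: bij_betw_def PiE_iff) blast
    moreover have "L = order_by A (restrict f A)"
      using f(2) by (auto simp: order_by_def)
    ultimately show "L \<in> order_by A ` ?F"
      by blast
  qed
  then have "card {L. linear_order_on A L} = card ?F"
    by (rule bij_betw_same_card[symmetric])
  also have "\<dots> = fact (card A)"
    by (subst card_inj_on_subset_funcset[OF fin]) (simp_all add: fact_prod_rev)
  finally show ?thesis .
qed

section \<open>Volume as probability in the unit cube\<close>

abbreviation unif :: "real measure" where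
  "unif \<equiv> uniform_measure lborel {0..1}"

text \<open>A product of identical probability measures allows permuting the coordinates and
  applying a measure-preserving map in each of them. Its space still consists of all extensional
  real functions; the unit box only has full measure.\<close>

abbreviation cube :: "'i set \<Rightarrow> ('i \<Rightarrow> real) measure" where
  "cube I \<equiv> \<Pi>\<^sub>M i\<in>I. unif"

lemma sets_cube: "sets (cube I) = sets (\<Pi>\<^sub>M i\<in>I. lborel)"
  by (intro sets_PiM_cong) auto

lemma prob_space_unif: "prob_space unif"
  by (rule prob_space_uniform_measure) auto

interpretation unif: prob_space unif
  by (rule prob_space_unif)

interpretation cube: product_prob_space "\<lambda>_. unif" I for I
  by unfold_locales

text \<open>Lebesgue measure with the indicator of the unit box as density agrees with
  \<open>cube I\<close> on all measurable boxes, so the two measures coincide. On subsets of the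
  unit box the density has no effect.\<close>

lemma vol_eq_cube:
  assumes fin: "finite I" and S: "S \<in> sets (cube I)" and sub: "S \<subseteq> I \<rightarrow>\<^sub>E {0..1}"
  shows "vol I S = measure (cube I) S"
proof -
  interpret L: product_sigma_finite "\<lambda>_::'a. lborel :: real measure"
    by standard
  let ?P = "\<Pi>\<^sub>M c\<in>I. (lborel :: real measure)"
  have box: "(I \<rightarrow>\<^sub>E {0..1}) \<in> sets ?P"
    using fin by (intro sets_PiM_I_finite) auto
  have "density ?P (indicator (I \<rightarrow>\<^sub>E {0..1})) = cube I"
  proof (rule cube.PiM_eqI[OF fin])
    show "sets (density ?P (indicator (I \<rightarrow>\<^sub>E {0..1}))) = sets (cube I)"
      by (simp add: sets_cube)
  next
    fix A :: "'a \<Rightarrow> real set" assume A: "\<And>i. i \<in> I \<Longrightarrow> A i \<in> sets unif"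
    have "emeasure (density ?P (indicator (I \<rightarrow>\<^sub>E {0..1}))) (Pi\<^sub>E I A)
        = emeasure ?P (Pi\<^sub>E I (\<lambda>i. {0..1} \<inter> A i))"
      using A fin box
      by (subst emeasure_density) (auto intro!: sets_PiM_I_finite
          simp: nn_integral_indicator simp flip: indicator_inter_arith PiE_Int)
    also have "\<dots> = (\<Prod>i\<in>I. emeasure unif (A i))"
      using A fin by (subst L.emeasure_PiM) (auto intro!: prod.cong simp: divide_ennreal_def)
    finally show "emeasure (density ?P (indicator (I \<rightarrow>\<^sub>E {0..1}))) (Pi\<^sub>E I A)
      = (\<Prod>i\<in>I. emeasure unif (A i))" .
  qed
  then have "emeasure (cube I) S = emeasure (density ?P (indicator (I \<rightarrow>\<^sub>E {0..1}))) S"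
    by simp
  also have "\<dots> = emeasure ?P ((I \<rightarrow>\<^sub>E {0..1}) \<inter> S)"
    using S box by (subst emeasure_density)
      (auto simp: sets_cube simp flip: indicator_inter_arith)
  also have "(I \<rightarrow>\<^sub>E {0..1}) \<inter> S = S"
    using sub by blast
  finally show ?thesis
    by (simp add: vol_def measure_def)
qed

lemma AE_cube_in_box:
  assumes "finite I"
  shows "AE p in cube I. p \<in> I \<rightarrow>\<^sub>E {0..1}"
proof (rule cube.AE_prob_1)
  show "measure (cube I) (I \<rightarrow>\<^sub>E {0..1}) = 1"
    using assms by (simp add: measure_def cube.emeasure_PiM)
qed

text \<open>By Fubini in the coordinate \<open>a\<close>: once the other coordinates are fixed, the
  condition confines \<open>p a\<close> to the single point \<open>p b\<close>, which is a null
  set.\<close>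

lemma AE_cube_neq:
  assumes fin: "finite I" and ab: "a \<in> I" "b \<in> I" "a \<noteq> b"
  shows "AE p in cube I. p a \<noteq> p b"
proof -
  define J where "J = I - {a}"
  have J: "I = insert a J" "a \<notin> J" "finite J" "b \<in> J"
    using assms by (auto simp: J_def)
  let ?S = "{p \<in> space (cube I). p a = p b}"
  have S[measurable]: "?S \<in> sets (cube I)"
    using ab by measurable
  have "emeasure (cube I) ?S = (\<integral>\<^sup>+p. indicator ?S p \<partial>cube (insert a J))"
    using S by (simp add: J(1))
  also have "\<dots> = (\<integral>\<^sup>+x. \<integral>\<^sup>+y. indicator ?S (x(a := y)) \<partial>unif \<partial>cube J)"
    using S J by (intro cube.product_nn_integral_insert) auto
  also have "\<dots> = (\<integral>\<^sup>+x. \<integral>\<^sup>+y. indicator {x b} y \<partial>unif \<partial>cube J)"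
    using J by (intro nn_integral_cong)
      (auto split: split_indicator simp: space_PiM PiE_def extensional_def)
  also have "\<dots> = (\<integral>\<^sup>+x. 0 \<partial>cube J)"
    by (intro nn_integral_cong) (auto simp: emeasure_lborel_countable)
  finally have "emeasure (cube I) ?S = 0"
    by simp
  then show ?thesis
    using S by (auto simp: AE_iff_measurable[OF _ refl])
qed

lemma AE_cube_inj:
  assumes "finite I"
  shows "AE p in cube I. inj_on p I"
proof -
  have "AE p in cube I. \<forall>a\<in>I. \<forall>b\<in>I - {a}. p a \<noteq> p b"
    using assms by (intro AE_finite_allI) (auto intro: AE_cube_neq)
  then show ?thesis
    by eventually_elim (auto simp: inj_on_def)
qed

section \<open>Order cells and order polytopes\<close>

lemma sets_cube_le: "a \<in> I \<Longrightarrow> b \<in> I \<Longrightarrow> {p \<in> space (cube I). p a \<le> p b} \<in> sets (cube I)"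
  unfolding sets_cube by (intro borel_measurable_le[where M = "cube I", unfolded sets_cube]) auto

lemma measurable_order_by:
  assumes "finite I"
  shows "{p \<in> space (cube I). order_by I p = L} \<in> sets (cube I)"
proof (cases "L \<subseteq> I \<times> I")
  case True
  then have "{p \<in> space (cube I). order_by I p = L}
      = {p \<in> space (cube I). \<forall>a\<in>I. \<forall>b\<in>I.
          ((a, b) \<in> L \<longrightarrow> p a \<le> p b) \<and> (p a \<le> p b \<longrightarrow> (a, b) \<in> L)}"
    by (auto simp: order_by_def)
  also have "\<dots> \<in> sets (cube I)"
    using assms
    by (intro sets.sets_Collect_finite_All sets.sets_Collect_conj sets.sets_Collect_imp
        sets.sets_Collect_const sets_cube_le)
  finally show ?thesis .
next
  case False
  then have "{p \<in> space (cube I). order_by I p = L} = {}"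
    by (auto simp: order_by_def)
  then show ?thesis
    by (simp only: sets.empty_sets)
qed

text \<open>Composing the ranking of \<open>L\<close> with the inverse ranking of \<open>K\<close>
  gives a permutation of \<open>I\<close> that carries \<open>L\<close> to \<open>K\<close>.
  Reindexing by it preserves the product measure, and the preimage of the cell of \<open>L\<close>
  is the cell of \<open>K\<close>.\<close>

lemma measure_order_cell_eq:
  assumes fin: "finite I" and L: "linear_order_on I L" and K: "linear_order_on I K"
  shows "measure (cube I) {p \<in> space (cube I). order_by I p = L}
    = measure (cube I) {p \<in> space (cube I). order_by I p = K}"
proof -
  obtain f :: "'a \<Rightarrow> nat" where f: "bij_betw f I {..<card I}" "L = order_by I f"
    using linear_order_on_eq_order_by[OF fin L] .
  obtain g :: "'a \<Rightarrow> nat" where g: "bij_betw g I {..<card I}" "K = order_by I g"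
    using linear_order_on_eq_order_by[OF fin K] .
  define \<pi> where "\<pi> = inv_into I g \<circ> f"
  have \<pi>: "bij_betw \<pi> I I"
    unfolding \<pi>_def by (rule bij_betw_trans[OF f(1) bij_betw_inv_into[OF g(1)]])
  have g\<pi>: "g (\<pi> i) = f i" if "i \<in> I" for i
    using f(1) g(1) that unfolding \<pi>_def
    by (metis bij_betw_apply bij_betw_inv_into_right comp_apply)
  let ?T = "\<lambda>p. \<lambda>i\<in>I. p (\<pi> i)"
  have T: "distr (cube I) (cube I) ?T = cube I"
    using \<pi> by (intro distr_PiM_reindex prob_space_unif) (auto simp: bij_betw_def)
  have T_meas: "?T \<in> cube I \<rightarrow>\<^sub>M cube I"
    using \<pi> by (intro measurable_restrict measurable_component_singleton) (auto simp: bij_betw_def)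
  have pull: "order_by I (?T p) = L \<longleftrightarrow> order_by I p = K" for p
  proof -
    have "order_by I (?T p) = L \<longleftrightarrow> (\<forall>a\<in>I. \<forall>b\<in>I. p (\<pi> a) \<le> p (\<pi> b) \<longleftrightarrow> g (\<pi> a) \<le> g (\<pi> b))"
      unfolding f(2) order_by_eq_iff by (simp add: g\<pi>)
    also have "\<dots> \<longleftrightarrow> (\<forall>a\<in>\<pi> ` I. \<forall>b\<in>\<pi> ` I. p a \<le> p b \<longleftrightarrow> g a \<le> g b)"
      by blast
    also have "\<dots> \<longleftrightarrow> order_by I p = K"
      using \<pi> unfolding g(2) order_by_eq_iff by (simp add: bij_betw_def)
    finally show ?thesis .
  qed
  have "measure (cube I) {p \<in> space (cube I). order_by I p = L}
      = measure (distr (cube I) (cube I) ?T) {p \<in> space (cube I). order_by I p = L}"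
    by (simp add: T)
  also have "\<dots> = measure (cube I) (?T -` {p \<in> space (cube I). order_by I p = L} \<inter> space (cube I))"
    by (rule measure_distr[OF T_meas measurable_order_by[OF fin]])
  also have "?T -` {p \<in> space (cube I). order_by I p = L} \<inter> space (cube I)
      = {p \<in> space (cube I). order_by I p = K}"
    using measurable_space[OF T_meas] by (auto simp: pull)
  finally show ?thesis .
qed

lemma finite_linear_orders: "finite A \<Longrightarrow> finite {L. linear_order_on A L}"
  by (rule card_ge_0_finite) (simp add: card_linear_orders)

text \<open>All cells have a common measure \<open>c\<close>. Applying additivity to the set of all
  linear orders gives \<open>fact (card I) * c = 1\<close>, which determines \<open>c\<close>;
  additivity over \<open>X\<close> then gives the claim.\<close>

lemma measure_order_cells:
  assumes fin: "finite I" and X: "X \<subseteq> {L. linear_order_on I L}"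
  shows "measure (cube I) {p \<in> space (cube I). order_by I p \<in> X} = card X / fact (card I)"
proof -
  let ?C = "\<lambda>L. {p \<in> space (cube I). order_by I p = L}"
  let ?A = "{L. linear_order_on I L}"
  define c where "c = measure (cube I) (?C (SOME L. linear_order_on I L))"
  have sum: "measure (cube I) {p \<in> space (cube I). order_by I p \<in> Y} = card Y * c"
    if Y: "Y \<subseteq> ?A" for Y
  proof -
    have c: "measure (cube I) (?C L) = c" if "L \<in> Y" for L
    proof -
      have L: "linear_order_on I L"
        using that Y by auto
      show ?thesis
        unfolding c_def by (rule measure_order_cell_eq[OF fin L someI[of "linear_order_on I" L, OF L]])
    qed
    have "{p \<in> space (cube I). order_by I p \<in> Y} = (\<Union>L\<in>Y. ?C L)"
      by blast
    also have "measure (cube I) \<dots> = (\<Sum>L\<in>Y. measure (cube I) (?C L))"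
      using finite_subset[OF Y finite_linear_orders[OF fin]] measurable_order_by[OF fin]
      by (intro cube.finite_measure_finite_Union) (auto simp: disjoint_family_on_def)
    finally show ?thesis
      by (simp add: c)
  qed
  have "measure (cube I) {p \<in> space (cube I). order_by I p \<in> ?A} = 1"
  proof (rule cube.prob_eq_1[THEN iffD2])
    have "{p \<in> space (cube I). order_by I p \<in> ?A} = (\<Union>L\<in>?A. ?C L)"
      by blast
    then show "{p \<in> space (cube I). order_by I p \<in> ?A} \<in> sets (cube I)"
      using finite_linear_orders[OF fin] measurable_order_by[OF fin] by auto
    \<comment> \<open>A point with a repeated coordinate violates antisymmetry and so lies in no
      cell, but such points form a null set.\<close>
    show "AE p in cube I. p \<in> {p \<in> space (cube I). order_by I p \<in> ?A}"
      using AE_cube_inj[OF fin] AE_space by eventually_elim (simp add: linear_order_order_by)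
  qed
  then have "fact (card I) * c = 1"
    using sum[of ?A] by (simp add: card_linear_orders[OF fin])
  then have "c = 1 / fact (card I)"
    by (simp add: field_simps)
  then show ?thesis
    using sum[OF X] by simp
qed

text \<open>A point with distinct coordinates induces a linear order, and it satisfies the
  inequalities from \<open>r\<close> exactly when that order contains \<open>r\<close>. Up to a null
  set the region is therefore the union of the cells of the linear extensions.\<close>

lemma measure_order_polytope:
  assumes fin: "finite I" and r: "r \<subseteq> I \<times> I"
  shows "measure (cube I) {p \<in> space (cube I). \<forall>(a, b)\<in>r. p a \<le> p b}
    = card (linear_extensions I r) / fact (card I)"
proof -
  have X: "linear_extensions I r \<subseteq> {L. linear_order_on I L}"
    by (auto simp: linear_extensions_def)
  have "{p \<in> space (cube I). order_by I p \<in> linear_extensions I r}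
      = (\<Union>L\<in>linear_extensions I r. {p \<in> space (cube I). order_by I p = L})"
    by blast
  also have "\<dots> \<in> sets (cube I)"
    using finite_subset[OF X finite_linear_orders[OF fin]] measurable_order_by[OF fin] by auto
  finally have m: "{p \<in> space (cube I). order_by I p \<in> linear_extensions I r} \<in> sets (cube I)" .
  have "{p \<in> space (cube I). \<forall>(a, b)\<in>r. p a \<le> p b}
      = {p \<in> space (cube I). \<forall>a\<in>I. \<forall>b\<in>I. (a, b) \<in> r \<longrightarrow> p a \<le> p b}"
    using r by auto
  also have "\<dots> \<in> sets (cube I)"
    using fin
    by (intro sets.sets_Collect_finite_All sets.sets_Collect_imp sets.sets_Collect_const sets_cube_le)
  finally have "measure (cube I) {p \<in> space (cube I). \<forall>(a, b)\<in>r. p a \<le> p b}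
      = measure (cube I) {p \<in> space (cube I). order_by I p \<in> linear_extensions I r}"
  proof (intro measure_eq_AE m)
    show "AE p in cube I. p \<in> {p \<in> space (cube I). \<forall>(a, b)\<in>r. p a \<le> p b} \<longleftrightarrow>
      p \<in> {p \<in> space (cube I). order_by I p \<in> linear_extensions I r}"
      using AE_cube_inj[OF fin]
    proof eventually_elim
      case (elim p)
      then show ?case
        using r linear_order_order_by[OF elim]
        by (auto simp: linear_extensions_def order_by_def)
    qed
  qed
  then show ?thesis
    using measure_order_cells[OF fin X] by simp
qed


section \<open>The tent map preserves the uniform distribution\<close>

definition tent :: "real \<Rightarrow> real" where
  "tent t = min (2 * t) (2 - 2 * t)"

lemma borel_measurable_tent[measurable]: "tent \<in> borel_measurable borel"
  unfolding tent_def by measurable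

text \<open>Each branch of the tent map is affine with slope 2 or -2 and maps one half of the unit
  interval onto the whole. \<open>F1\<close> and \<open>F2\<close> are the contributions of the two
  branches to the preimage of \<open>A\<close>; each is half of the measure \<open>F\<close> of
  \<open>A\<close> in the unit interval.\<close>

lemma distr_unif_tent: "distr unif unif tent = unif"
proof (rule measure_eqI)
  fix A assume "A \<in> sets (distr unif unif tent)"
  then have A[measurable]: "A \<in> sets borel"
    by simp
  define f :: "real \<Rightarrow> ennreal" where "f = indicator ({0..1} \<inter> A)"
  have f[measurable]: "f \<in> borel_measurable borel"
    unfolding f_def by measurable
  define F F1 F2 where "F = (\<integral>\<^sup>+t. f t \<partial>lborel)"
    and "F1 = (\<integral>\<^sup>+t. f (2 * t) \<partial>lborel)" and "F2 = (\<integral>\<^sup>+t. f (2 - 2 * t) \<partial>lborel)"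
  have F1: "F = 2 * F1" and F2: "F = 2 * F2"
    using nn_integral_real_affine[OF f, of 2 0] nn_integral_real_affine[OF f, of "- 2" 2]
    by (simp_all add: F_def F1_def F2_def)
  have pre[measurable]: "tent -` A \<in> sets borel"
    using measurable_sets_borel[OF borel_measurable_tent A] .
  then have "emeasure (distr unif unif tent) A = emeasure lborel ({0..1} \<inter> tent -` A)"
    by (subst emeasure_distr) (auto simp: divide_ennreal_def)
  also have "\<dots> = (\<integral>\<^sup>+t. indicator ({0..1} \<inter> tent -` A) t \<partial>lborel)"
    using pre by simp
  also have "\<dots> = (\<integral>\<^sup>+t. f (2 * t) + f (2 - 2 * t) \<partial>lborel)"
  proof (rule nn_integral_cong_AE)
    \<comment> \<open>At 1/2 both branches take the value 1, so the sum could count this point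
      twice. Elsewhere only one of the two arguments lies in the unit interval.\<close>
    show "AE t in lborel. indicator ({0..1} \<inter> tent -` A) t = f (2 * t) + f (2 - 2 * t)"
      using AE_lborel_singleton[of "1 / 2"]
    proof eventually_elim
      case (elim t)
      then consider "t < 1 / 2" | "t > 1 / 2"
        by (auto simp: neq_iff)
      then show ?case
        by cases (simp_all add: f_def tent_def indicator_def)
    qed
  qed
  also have "\<dots> = F1 + F2"
    unfolding F1_def F2_def by (intro nn_integral_add) measurable
  also have "\<dots> = F"
  proof -
    \<comment> \<open>Cancelling the finite factor 2 is valid in \<open>ennreal\<close> even for
      infinite values; then \<open>F1 + F2\<close> is \<open>F1 + F1\<close>, that is,
      \<open>F\<close>.\<close>
    have "2 * F1 = 2 * F2"
      by (rule trans[OF F1[symmetric] F2])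
    then have "F1 = F2"
      by (simp add: ennreal_mult_cancel_left)
    then show ?thesis
      unfolding F1 mult_2 by simp
  qed
  also have "\<dots> = emeasure unif A"
    by (simp add: F_def f_def divide_ennreal_def)
  finally show "emeasure (distr unif unif tent) A = emeasure unif A" .
qed simp

section \<open>Fibre lengths and integration over the vertex values\<close>

lemma emeasure_unif_interval:
  assumes "0 \<le> a" "a \<le> b" "b \<le> 1"
  shows "emeasure unif {a..b} = ennreal (b - a)"
proof -
  have "{0..1} \<inter> {a..b} = {a..b}"
    using assms by auto
  then show ?thesis
    using assms by (simp add: divide_ennreal_def)
qed

lemma emeasure_unif_atMost:
  assumes "0 \<le> b" "b \<le> 1"
  shows "emeasure unif {..b} = ennreal b"
proof -
  have "{0..1} \<inter> {..b} = {0..b}"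
    using assms by auto
  then show ?thesis
    using assms by (simp add: divide_ennreal_def)
qed

text \<open>By symmetry let \<open>a\<close> be at most \<open>b\<close>. The interval then has
  length \<open>min a (1 - b)\<close>, while among \<open>2 * a\<close>, \<open>2 - 2 * a\<close>,
  \<open>2 * b\<close> and \<open>2 - 2 * b\<close> the least is twice this number.\<close>

lemma emeasure_unif_McCormick:
  assumes "a \<in> {0..1}" "b \<in> {0..1}"
  shows "emeasure unif {max 0 (a + b - 1)..min a b} = ennreal (1 / 2) * ennreal (min (tent a) (tent b))"
proof -
  have "emeasure unif {max 0 (a + b - 1)..min a b} = ennreal (min a b - max 0 (a + b - 1))"
    using assms by (intro emeasure_unif_interval) auto
  also have "min a b - max 0 (a + b - 1) = 1 / 2 * min (tent a) (tent b)"
    by (auto simp: tent_def min_def max_def)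
  also have "ennreal \<dots> = ennreal (1 / 2) * ennreal (min (tent a) (tent b))"
    using assms by (intro ennreal_mult) (auto simp: tent_def)
  finally show ?thesis .
qed

text \<open>By Fubini: for fixed base coordinates \<open>x\<close>, the fibre is the box with sides
  \<open>B x j\<close>, so its measure is a product.\<close>

lemma emeasure_cube_fibred:
  assumes IJ: "I \<inter> J = {}" "finite I" "finite J"
    and S: "S \<in> sets (cube (I \<union> J))"
    and B: "\<And>x j. j \<in> J \<Longrightarrow> B x j \<in> sets borel"
    and eq: "\<And>x y. x \<in> space (cube I) \<Longrightarrow> y \<in> space (cube J) \<Longrightarrow>
      merge I J (x, y) \<in> S \<longleftrightarrow> (\<forall>j\<in>J. y j \<in> B x j)"
  shows "emeasure (cube (I \<union> J)) S = (\<integral>\<^sup>+x. (\<Prod>j\<in>J. emeasure unif (B x j)) \<partial>cube I)"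
proof -
  have "emeasure (cube (I \<union> J)) S = (\<integral>\<^sup>+p. indicator S p \<partial>cube (I \<union> J))"
    using S by simp
  also have "\<dots> = (\<integral>\<^sup>+x. \<integral>\<^sup>+y. indicator S (merge I J (x, y)) \<partial>cube J \<partial>cube I)"
    using S IJ by (intro cube.product_nn_integral_fold) auto
  also have "\<dots> = (\<integral>\<^sup>+x. \<integral>\<^sup>+y. indicator (Pi\<^sub>E J (B x)) y \<partial>cube J \<partial>cube I)"
    by (intro nn_integral_cong) (auto split: split_indicator simp: eq space_PiM PiE_iff)
  also have "\<dots> = (\<integral>\<^sup>+x. (\<Prod>j\<in>J. emeasure unif (B x j)) \<partial>cube I)"
    using IJ B by (intro nn_integral_cong)
      (simp add: cube.emeasure_PiM sets_PiM_I_finite)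
  finally show ?thesis .
qed

text \<open>Here \<open>I\<close> stands for the vertices, \<open>J\<close> for the edges, and
  \<open>u j\<close>, \<open>w j\<close> for the endpoints of \<open>j\<close>. For almost every
  \<open>x\<close> the fibre of \<open>P\<close> has measure \<open>G x\<close>, and that of
  \<open>Q\<close> has measure \<open>(1 / 2) ^ card J * G (compose I tent x)\<close>. The tent map
  in every coordinate preserves \<open>cube I\<close>, so both occurrences of \<open>G\<close> have
  the same integral, even when edges share endpoints.\<close>

lemma measure_McCormick_eq:
  fixes u w :: "'i \<Rightarrow> 'i"
  assumes IJ: "I \<inter> J = {}" "finite I" "finite J"
    and uw: "\<And>j. j \<in> J \<Longrightarrow> u j \<in> I" "\<And>j. j \<in> J \<Longrightarrow> w j \<in> I"
  defines "Q \<equiv> {p \<in> space (cube (I \<union> J)).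
      \<forall>j\<in>J. p j \<in> {max 0 (p (u j) + p (w j) - 1)..min (p (u j)) (p (w j))}}"
    and "P \<equiv> {p \<in> space (cube (I \<union> J)). \<forall>j\<in>J. p j \<in> {..min (p (u j)) (p (w j))}}"
  shows "Q \<in> sets (cube (I \<union> J))" and "P \<in> sets (cube (I \<union> J))"
    and "measure (cube (I \<union> J)) Q = measure (cube (I \<union> J)) P / 2 ^ card J"
proof -
  have comp[measurable]: "(\<lambda>p. p i) \<in> borel_measurable (cube K)" if "i \<in> K" for i K
    using that measurable_component_singleton[of i K "\<lambda>_. unif"] by simp
  show Q: "Q \<in> sets (cube (I \<union> J))"
    unfolding Q_def atLeastAtMost_iff using IJ uw
    by (intro sets.sets_Collect_finite_All sets.sets_Collect_conj borel_measurable_le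
        borel_measurable_max borel_measurable_min borel_measurable_diff borel_measurable_add
        borel_measurable_const comp) auto
  show P: "P \<in> sets (cube (I \<union> J))"
    unfolding P_def atMost_iff using IJ uw
    by (intro sets.sets_Collect_finite_All borel_measurable_le borel_measurable_min comp) auto
  define G where "G x = (\<Prod>j\<in>J. ennreal (min (x (u j)) (x (w j))))" for x :: "'i \<Rightarrow> real"
  have G[measurable]: "G \<in> borel_measurable (cube I)"
    unfolding G_def using IJ uw
    by (intro borel_measurable_prod_ennreal measurable_compose[OF _ measurable_ennreal]
        borel_measurable_min comp) auto
  have merge: "merge I J (x, y) \<in> space (cube (I \<union> J))"
    "j \<in> J \<Longrightarrow> merge I J (x, y) j = y j"
    "j \<in> J \<Longrightarrow> merge I J (x, y) (u j) = x (u j)"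
    "j \<in> J \<Longrightarrow> merge I J (x, y) (w j) = x (w j)" for x y j
    using IJ uw by (auto simp: merge_def space_PiM PiE_iff extensional_def)
  have T: "distr (cube I) (cube I) (compose I tent) = cube I"
    using distr_PiM_finite_prob_space'[of I "\<lambda>_. unif" "\<lambda>_. unif" tent] IJ
    by (simp add: prob_space_unif distr_unif_tent)
  have T_meas: "compose I tent \<in> cube I \<rightarrow>\<^sub>M cube I"
    unfolding compose_def
    by (intro measurable_restrict) (auto intro!: measurable_compose[OF comp])
  have "emeasure (cube (I \<union> J)) P = (\<integral>\<^sup>+x. (\<Prod>j\<in>J. emeasure unif {..min (x (u j)) (x (w j))}) \<partial>cube I)"
    using IJ P by (intro emeasure_cube_fibred) (auto simp: P_def merge)
  also have "\<dots> = (\<integral>\<^sup>+x. G x \<partial>cube I)"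
  proof (rule nn_integral_cong_AE)
    \<comment> \<open>The length formulas require vertex values in the unit interval, which hold
      only almost everywhere.\<close>
    show "AE x in cube I. (\<Prod>j\<in>J. emeasure unif {..min (x (u j)) (x (w j))}) = G x"
      using AE_cube_in_box[OF IJ(2)]
    proof eventually_elim
      case (elim x)
      then show ?case
        unfolding G_def using uw
        by (intro prod.cong refl emeasure_unif_atMost) (auto simp: PiE_iff min_le_iff_disj)
    qed
  qed
  finally have vO: "emeasure (cube (I \<union> J)) P = (\<integral>\<^sup>+x. G x \<partial>cube I)" .
  have "emeasure (cube (I \<union> J)) Q = (\<integral>\<^sup>+x. (\<Prod>j\<in>J.
      emeasure unif {max 0 (x (u j) + x (w j) - 1)..min (x (u j)) (x (w j))}) \<partial>cube I)"
    using IJ Q by (intro emeasure_cube_fibred) (auto simp: Q_def merge)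
  also have "\<dots> = (\<integral>\<^sup>+x. ennreal (1 / 2) ^ card J * G (compose I tent x) \<partial>cube I)"
  proof (rule nn_integral_cong_AE)
    show "AE x in cube I. (\<Prod>j\<in>J.
        emeasure unif {max 0 (x (u j) + x (w j) - 1)..min (x (u j)) (x (w j))})
      = ennreal (1 / 2) ^ card J * G (compose I tent x)"
      using AE_cube_in_box[OF IJ(2)]
    proof eventually_elim
      case (elim x)
      then have "(\<Prod>j\<in>J. emeasure unif {max 0 (x (u j) + x (w j) - 1)..min (x (u j)) (x (w j))})
        = (\<Prod>j\<in>J. ennreal (1 / 2) * ennreal (min (tent (x (u j))) (tent (x (w j)))))"
        using uw by (intro prod.cong refl emeasure_unif_McCormick) (auto simp: PiE_iff)
      also have "\<dots> = ennreal (1 / 2) ^ card J * G (compose I tent x)"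
        unfolding prod.distrib prod_constant G_def using uw
        by (intro arg_cong2[where f = "(*)"] prod.cong refl) (simp add: compose_eq)
      finally show ?case .
    qed
  qed
  also have "\<dots> = ennreal (1 / 2) ^ card J * (\<integral>\<^sup>+x. G (compose I tent x) \<partial>cube I)"
    by (intro nn_integral_cmult measurable_compose[OF T_meas G])
  also have "(\<integral>\<^sup>+x. G (compose I tent x) \<partial>cube I)
      = (\<integral>\<^sup>+x. G x \<partial>distr (cube I) (cube I) (compose I tent))"
    by (rule nn_integral_distr[symmetric, OF T_meas]) simp
  also have "\<dots> = emeasure (cube (I \<union> J)) P"
    by (simp only: T vO)
  also have "ennreal (1 / 2) ^ card J = ennreal ((1 / 2) ^ card J)"
    by (rule ennreal_power) simp
  finally have "measure (cube (I \<union> J)) Q = enn2real (ennreal ((1 / 2) ^ card J)) * measure (cube (I \<union> J)) P"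
    by (simp only: measure_def enn2real_mult)
  also have "enn2real (ennreal ((1 / 2) ^ card J)) = (1 / 2) ^ card J"
    by (rule enn2real_ennreal) simp
  finally show "measure (cube (I \<union> J)) Q = measure (cube (I \<union> J)) P / 2 ^ card J"
    by (simp add: power_one_over)
qed

section \<open>The incidence poset and the two polytopes\<close>

lemma incidence_order_respects:
  assumes E: "\<And>e. e \<in> E \<Longrightarrow> e \<subseteq> V"
  shows "(\<forall>(a, b)\<in>incidence_order V E. p a \<le> p b) \<longleftrightarrow> (\<forall>e\<in>E. \<forall>i\<in>e. p (YC e) \<le> (p (XC i) :: real))"
proof
  assume L: "\<forall>(a, b)\<in>incidence_order V E. p a \<le> p b"
  show "\<forall>e\<in>E. \<forall>i\<in>e. p (YC e) \<le> p (XC i)"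
  proof (intro ballI)
    fix e i assume "e \<in> E" "i \<in> e"
    then have "(YC e, XC i) \<in> incidence_order V E"
      using E unfolding incidence_order_def coords_def by blast
    then show "p (YC e) \<le> p (XC i)"
      using L by auto
  qed
next
  assume R: "\<forall>e\<in>E. \<forall>i\<in>e. p (YC e) \<le> p (XC i)"
  \<comment> \<open>The order of the reals is reflexive and transitive, so the inequalities for the
    generating pairs pass to the closure.\<close>
  have "p a \<le> p b" if "(a, b) \<in> {(YC e, XC i) | e i. e \<in> E \<and> i \<in> e}\<^sup>*" for a b
    using that by induction (use R in force)+
  then show "\<forall>(a, b)\<in>incidence_order V E. p a \<le> p b"
    by (auto simp: incidence_order_def)
qed

theorem theorem4:
  fixes V :: "'v set" and E :: "'v set set" and d :: nat
  assumes "simple_graph V E"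
    and "d = card V + card E"
  shows "vol (coords V E) (polytope_Q V E) = vol (coords V E) (polytope_O V E) / 2 ^ card E \<and>
    vol (coords V E) (polytope_O V E) / 2 ^ card E =
      real (card (linear_extensions (coords V E) (incidence_order V E))) / (fact d * 2 ^ card E)"
proof -
  have V: "finite V" and E_sub: "\<And>e. e \<in> E \<Longrightarrow> e \<subseteq> V" and E_card: "\<And>e. e \<in> E \<Longrightarrow> card e = 2"
    using assms(1) by (auto simp: simple_graph_def)
  have E: "finite E"
    using V E_sub by (intro finite_subset[of E "Pow V"]) auto
  have "\<forall>e\<in>E. \<exists>i j. e = {i, j}"
    using E_card by (meson card_2_iff)
  then obtain u w where uw: "\<And>e. e \<in> E \<Longrightarrow> e = {u e, w e}"
    by metis
  let ?X = "XC ` V" and ?Y = "YC ` E :: 'v coord set"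
  let ?C = "coords V E"
  \<comment> \<open>The values on vertex coordinates are unspecified; both functions are applied
    only to edge coordinates.\<close>
  let ?u = "\<lambda>c. case c of YC e \<Rightarrow> XC (u e)" and ?w = "\<lambda>c. case c of YC e \<Rightarrow> XC (w e)"
  have C: "?C = ?X \<union> ?Y" and finC: "finite ?C" and dis: "?X \<inter> ?Y = {}"
    using V E by (auto simp: coords_def)
  have cardY: "card ?Y = card E"
    by (intro card_image) (auto simp: inj_on_def)
  have cardC: "card ?C = d"
    using V E dis unfolding C by (simp add: card_Un_disjoint cardY card_image inj_on_def assms(2))
  \<comment> \<open>The polytopes quantify over both orderings of the endpoints of an edge. For a
    condition symmetric in them, the one ordering chosen by \<open>u\<close> and \<open>w\<close>
    suffices.\<close>
  have edge: "(\<forall>i j. {i, j} \<in> E \<longrightarrow> R {i, j} i j) \<longleftrightarrow> (\<forall>e\<in>E. R e (u e) (w e))"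
    if "\<And>e i j. R e i j \<longleftrightarrow> R e j i" for R :: "'v set \<Rightarrow> 'v \<Rightarrow> 'v \<Rightarrow> bool"
  proof (intro iffI allI impI ballI)
    fix e assume "\<forall>i j. {i, j} \<in> E \<longrightarrow> R {i, j} i j" "e \<in> E"
    then show "R e (u e) (w e)"
      using uw by metis
  next
    fix i j assume h: "\<forall>e\<in>E. R e (u e) (w e)" "{i, j} \<in> E"
    then have "{i, j} = {u {i, j}, w {i, j}}"
      using uw by blast
    then have "(i = u {i, j} \<and> j = w {i, j}) \<or> (i = w {i, j} \<and> j = u {i, j})"
      by (simp add: doubleton_eq_iff)
    then show "R {i, j} i j"
      using h that by metis
  qed
  define Q where "Q = {p \<in> space (cube ?C).
      \<forall>j\<in>?Y. p j \<in> {max 0 (p (?u j) + p (?w j) - 1)..min (p (?u j)) (p (?w j))}}"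
  define P where "P = {p \<in> space (cube ?C). \<forall>j\<in>?Y. p j \<in> {..min (p (?u j)) (p (?w j))}}"
  have uwX: "?u j \<in> ?X" "?w j \<in> ?X" if "j \<in> ?Y" for j
    using that uw E_sub by fastforce+
  have QP: "Q \<in> sets (cube ?C)" "P \<in> sets (cube ?C)"
      "measure (cube ?C) Q = measure (cube ?C) P / 2 ^ card ?Y"
    unfolding Q_def P_def C
    by (rule measure_McCormick_eq; (rule dis | erule uwX | simp add: V E))
      (rule measure_McCormick_eq; (rule dis | erule uwX | simp add: V E))+
  have box: "?C \<rightarrow>\<^sub>E {0..1} \<in> sets (cube ?C)"
    using finC by (intro sets_PiM_I_finite) auto
  \<comment> \<open>\<open>Q\<close> and \<open>P\<close> carry only the edge inequalities. Cutting
    with the unit box gives the polytopes and discards a null set of \<open>cube ?C\<close>.\<close>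
  have vol: "vol ?C (S \<inter> (?C \<rightarrow>\<^sub>E {0..1})) = measure (cube ?C) S" if S: "S \<in> sets (cube ?C)" for S
  proof -
    have "vol ?C (S \<inter> (?C \<rightarrow>\<^sub>E {0..1})) = measure (cube ?C) (S \<inter> (?C \<rightarrow>\<^sub>E {0..1}))"
      using S box by (intro vol_eq_cube finC) auto
    also have "\<dots> = measure (cube ?C) S"
      using AE_cube_in_box[OF finC] S box by (intro measure_eq_AE) auto
    finally show ?thesis .
  qed
  \<comment> \<open>The four inequalities of an edge place its coordinate between the larger of two
    lower bounds and the smaller of two upper bounds.\<close>
  have PQ: "polytope_Q V E = Q \<inter> (?C \<rightarrow>\<^sub>E {0..1})"
  proof -
    have "(\<forall>i j. {i, j} \<in> E \<longrightarrow> p (YC {i, j}) \<ge> 0 \<and> p (YC {i, j}) \<le> p (XC i) \<and>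
        p (YC {i, j}) \<le> p (XC j) \<and> p (XC i) + p (XC j) \<le> 1 + p (YC {i, j})) \<longleftrightarrow>
      (\<forall>j\<in>?Y. p j \<in> {max 0 (p (?u j) + p (?w j) - 1)..min (p (?u j)) (p (?w j))})"
      for p :: "'v coord \<Rightarrow> real"
      by (subst edge[of "\<lambda>e i j. p (YC e) \<ge> 0 \<and> p (YC e) \<le> p (XC i) \<and>
        p (YC e) \<le> p (XC j) \<and> p (XC i) + p (XC j) \<le> 1 + p (YC e)"]) auto
    then show ?thesis
      unfolding polytope_Q_def Q_def by (auto simp: space_PiM)
  qed
  have PO: "polytope_O V E = P \<inter> (?C \<rightarrow>\<^sub>E {0..1})"
  proof -
    have "(\<forall>i j. {i, j} \<in> E \<longrightarrow> p (YC {i, j}) \<le> p (XC i) \<and> p (YC {i, j}) \<le> p (XC j)) \<longleftrightarrow>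
      (\<forall>j\<in>?Y. p j \<in> {..min (p (?u j)) (p (?w j))})" for p :: "'v coord \<Rightarrow> real"
      by (subst edge[of "\<lambda>e i j. p (YC e) \<le> p (XC i) \<and> p (YC e) \<le> p (XC j)"]) auto
    then show ?thesis
      unfolding polytope_O_def P_def by (auto simp: space_PiM)
  qed
  \<comment> \<open>Lying below the minimum of the endpoint values means lying below each of them,
    so \<open>P\<close> is cut out by the generators of the incidence order.\<close>
  have "P = {p \<in> space (cube ?C). \<forall>(a, b)\<in>incidence_order V E. p a \<le> p b}"
  proof -
    have "(\<forall>i\<in>e. p (YC e) \<le> p (XC i)) \<longleftrightarrow> p (YC e) \<le> min (p (XC (u e))) (p (XC (w e)))"
      if "e \<in> E" for e and p :: "'v coord \<Rightarrow> real"
      using arg_cong[OF uw[OF that], of "\<lambda>S. \<forall>i\<in>S. p (YC e) \<le> p (XC i)"] by simp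
    moreover have "(\<forall>(a, b)\<in>incidence_order V E. p a \<le> p b) \<longleftrightarrow>
      (\<forall>e\<in>E. \<forall>i\<in>e. p (YC e) \<le> p (XC i))" for p :: "'v coord \<Rightarrow> real"
      using E_sub by (rule incidence_order_respects)
    ultimately show ?thesis
      unfolding P_def by simp
  qed
  then have "measure (cube ?C) P = card (linear_extensions ?C (incidence_order V E)) / fact d"
    using measure_order_polytope[OF finC, of "incidence_order V E"]
    by (simp add: cardC incidence_order_def)
  then show ?thesis
    using QP by (simp add: PQ PO vol cardY)
qed

end
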